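(* Let $S=\{C_1,\dots,C_n\}$ be a finite set of propositional clauses and let $\phi_1,\phi_2,\dots,\phi_t$ be a deduction sequence of contradiction separation based on standard extension from $S$ to $\phi_t$. If $\phi_t=\emptyset$ (the empty clause), then $S$ is unsatisfiable.
   Context: Propositional logic. A literal is a propositional variable or its negation; $p$ and $\neg p$ are complementary. A clause is a finite disjunction of literals, identified with the finite set of its literals; $\emptyset$ is the empty clause. Contradiction separation based on standard extension: let $m\ge2$, let $D_1,\dots,D_m$ be clauses (repetitions allowed) and $x_1,\dots,x_{m-1}$ literals, and suppose sub-clauses $D_i^-\subseteq D_i$ are chosen with $D_1^-=\{x_1\}$, $D_i^-=\{x_i,\neg x_{i-1}\}\cup D^i$ for $2\le i\le m-1$, $D_m^-=\{\neg x_{m-1}\}\cup D^m$, where $D^2=\emptyset$ and $D^j\subseteq\{\neg x_1,\dots,\neg x_{j-2}\}$ for $3\le j\le m$. Put $D_i^+=D_i\setminus D_i^-$. Then the clause $R_s(D_1,\dots,D_m)=\bigcup_{i=1}^m D_i^+$ is called a contradiction separation clause based on standard extension of $D_1,\dots,D_m$. A deduction sequence of contradiction separation based on standard extension from $S$ to $\phi_t$ is a finite sequence of clauses $\phi_1,\dots,\phi_t$ such that each $\phi_i$ either belongs to $S$, or there exist indices $r_1,\dots,r_{k_i}<i$ such that $\phi_i$ is a contradiction separation clause based on standard extension $R_s(\phi_{r_1},\dots,\phi_{r_{k_i}})$. *)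

theory Defs
  imports Main "HOL-Library.FSet"
begin

datatype 'a literal = Pos 'a | Neg 'a

fun complement :: "'a literal \<Rightarrow> 'a literal" where
  "complement (Pos p) = Neg p"
| "complement (Neg p) = Pos p"

(* Tautological clauses, containing a complementary pair, are allowed. *)
type_synonym 'a clause = "'a literal fset"

fun literal_true :: "('a \<Rightarrow> bool) \<Rightarrow> 'a literal \<Rightarrow> bool" where
  "literal_true v (Pos p) \<longleftrightarrow> v p"
| "literal_true v (Neg p) \<longleftrightarrow> \<not> v p"

definition clause_true :: "('a \<Rightarrow> bool) \<Rightarrow> 'a clause \<Rightarrow> bool" where
  "clause_true v C \<longleftrightarrow> (\<exists>l. l |\<in>| C \<and> literal_true v l)"

definition satisfiable :: "'a clause set \<Rightarrow> bool" where
  "satisfiable S \<longleftrightarrow> (\<exists>v. \<forall>C\<in>S. clause_true v C)"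

(* Families are functions on nat of which only the arguments 1, ..., m
   (1, ..., m - 1 for x, and 2, ..., m for E) matter. Dm i is the chosen sub-clause
   of D i that is written with a superscript minus, and E i is its additional
   part, written with the plain superscript i. *)
definition standard_extension ::
  "nat \<Rightarrow> (nat \<Rightarrow> 'a literal) \<Rightarrow> (nat \<Rightarrow> 'a clause) \<Rightarrow> (nat \<Rightarrow> 'a clause) \<Rightarrow> bool" where
  "standard_extension m x E Dm \<longleftrightarrow>
     Dm 1 = {|x 1|} \<and>
     (\<forall>i\<in>{2..m - 1}. Dm i = {|x i, complement (x (i - 1))|} |\<union>| E i) \<and>
     Dm m = {|complement (x (m - 1))|} |\<union>| E m \<and>
     E 2 = {||} \<and>
     (\<forall>j\<in>{3..m}. fset (E j) \<subseteq> {complement (x k) |k. 1 \<le> k \<and> k \<le> j - 2})"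

(* R is one of the possible values of R_s(D 1, ..., D m): the separated clause also
   depends on the choice of the literals and of the sub-clauses, so this is a relation. *)
definition is_cs_clause :: "nat \<Rightarrow> (nat \<Rightarrow> 'a clause) \<Rightarrow> 'a clause \<Rightarrow> bool" where
  "is_cs_clause m D R \<longleftrightarrow>
     2 \<le> m \<and>
     (\<exists>x E Dm. standard_extension m x E Dm \<and>
        (\<forall>i\<in>{1..m}. Dm i |\<subseteq>| D i) \<and>
        fset R = (\<Union>i\<in>{1..m}. fset (D i |-| Dm i)))"

(* The sequence is \<phi> 1, ..., \<phi> t; values of \<phi> elsewhere are irrelevant. *)
definition deduction_sequence :: "'a clause set \<Rightarrow> nat \<Rightarrow> (nat \<Rightarrow> 'a clause) \<Rightarrow> bool" where
  "deduction_sequence S t \<phi> \<longleftrightarrow>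
     1 \<le> t \<and>
     (\<forall>i\<in>{1..t}. \<phi> i \<in> S \<or>
        (\<exists>k r. (\<forall>j\<in>{1..k}. 1 \<le> r j \<and> r j < i) \<and>
               is_cs_clause k (\<lambda>j. \<phi> (r j)) (\<phi> i)))"

end

theory Submission
  imports Defs
begin

text \<open>
  A valuation satisfying all the clauses \<open>Dm 1, \<dots>, Dm m\<close> of a standard extension makes
  \<open>x 1, \<dots>, x (m - 1)\<close> true one after the other, since every other literal of \<open>Dm i\<close> is the
  complement of an earlier \<open>x k\<close>. Then it falsifies \<open>Dm m\<close>, so the chosen sub-clauses are
  contradictory. Hence a model of the parent clauses falsifies one of the chosen sub-clauses and
  satisfies the corresponding remainder, which is part of the separation clause.
\<close>

lemma literal_true_complement [simp]:
  "literal_true v (complement l) \<longleftrightarrow> \<not> literal_true v l"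
  by (cases l) auto

lemma standard_extension_unsatisfiable:
  assumes ext: "standard_extension m x E Dm" and "2 \<le> m"
  shows "\<exists>i\<in>{1..m}. \<not> clause_true v (Dm i)"
proof (rule ccontr)
  assume "\<not> ?thesis"
  then have all_true: "clause_true v (Dm i)" if "1 \<le> i" "i \<le> m" for i
    using that by auto
  \<comment> \<open>The bound \<open>k \<le> j - 2\<close> is relaxed to \<open>k < j\<close>, so
    that the literals of \<open>E j\<close> and \<open>complement (x (j - 1))\<close> take one
    common form; for \<open>j = 2\<close> the set is empty.\<close>
  have E_sub: "\<exists>k. 1 \<le> k \<and> k < j \<and> l = complement (x k)"
    if j: "2 \<le> j" "j \<le> m" and l: "l |\<in>| E j" for j l
  proof (cases "j = 2")
    case True
    then show ?thesis
      using ext j l by (simp add: standard_extension_def)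
  next
    case False
    then have "fset (E j) \<subseteq> {complement (x k) |k. 1 \<le> k \<and> k \<le> j - 2}"
      using ext j l by (simp add: standard_extension_def)
    then obtain k where "1 \<le> k" "k \<le> j - 2" "l = complement (x k)"
      using l by blast
    then show ?thesis
      using j by (intro exI[of _ k]) auto
  qed
  have x_true: "literal_true v (x i)" if "1 \<le> i" "i < m" for i
    using that
  \<comment> \<open>Strong induction, since \<open>E i\<close> may contain the complement of any
    \<open>x k\<close> with \<open>k \<le> i - 2\<close>.\<close>
  proof (induction i rule: less_induct)
    case (less i)
    obtain l where l: "l |\<in>| Dm i" "literal_true v l"
      using all_true[of i] less.prems by (auto simp: clause_true_def)
    show ?case
    proof (cases "i = 1")
      case True
      then show ?thesis
        using ext l by (auto simp: standard_extension_def)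
    next
      case False
      then have "Dm i = {|x i, complement (x (i - 1))|} |\<union>| E i"
        using ext less.prems by (simp add: standard_extension_def)
      then consider "l = x i" | "l = complement (x (i - 1))" | "l |\<in>| E i"
        using l(1) by auto
      then have "l = x i \<or> (\<exists>k. 1 \<le> k \<and> k < i \<and> l = complement (x k))"
      proof cases
        case 2
        then show ?thesis
          using less.prems False by (intro disjI2 exI[of _ "i - 1"]) auto
      qed (use E_sub[of i l] less.prems False in auto)
      \<comment> \<open>By the induction hypothesis the second alternative would make
        \<open>l\<close> false, so \<open>l\<close> is \<open>x i\<close>.\<close>
      then show ?thesis
        using l(2) less.IH less.prems by auto
    qed
  qed
  obtain l where l: "l |\<in>| Dm m" "literal_true v l"
    using all_true[of m] \<open>2 \<le> m\<close> by (auto simp: clause_true_def)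
  have "Dm m = {|complement (x (m - 1))|} |\<union>| E m"
    using ext by (simp add: standard_extension_def)
  then consider "l = complement (x (m - 1))" | "l |\<in>| E m"
    using l(1) by auto
  \<comment> \<open>The last sub-clause brings no new literal \<open>x m\<close>, so all its
    literals are complements of true ones.\<close>
  then have "\<exists>k. 1 \<le> k \<and> k < m \<and> l = complement (x k)"
  proof cases
    case 1
    then show ?thesis
      using \<open>2 \<le> m\<close> by (intro exI[of _ "m - 1"]) auto
  qed (use E_sub[of m l] \<open>2 \<le> m\<close> in auto)
  then show False
    using l(2) x_true by auto
qed

lemma is_cs_clause_sound:
  assumes cs: "is_cs_clause m D R"
    and parents: "\<And>i. i \<in> {1..m} \<Longrightarrow> clause_true v (D i)"
  shows "clause_true v R"
proof -
  obtain x E Dm where "2 \<le> m" and ext: "standard_extension m x E Dm"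
    and R: "fset R = (\<Union>i\<in>{1..m}. fset (D i |-| Dm i))"
    using cs by (auto simp: is_cs_clause_def)
  then obtain i where i: "i \<in> {1..m}" "\<not> clause_true v (Dm i)"
    using standard_extension_unsatisfiable[OF ext] by blast
  obtain l where "l |\<in>| D i" "literal_true v l"
    using parents[OF i(1)] by (auto simp: clause_true_def)
  \<comment> \<open>Any true literal of \<open>D i\<close> will do, because \<open>Dm i\<close>
    contains none.\<close>
  moreover from this have "l |\<notin>| Dm i"
    using i(2) by (auto simp: clause_true_def)
  ultimately have "l \<in> fset R"
    unfolding R using i(1) by auto
  then show ?thesis
    using \<open>literal_true v l\<close> by (auto simp: clause_true_def)
qed

text \<open>Each inference preserves truth under the fixed \<open>v\<close>, and its parents may
  stand anywhere earlier in the sequence, hence strong induction on the position.\<close>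

lemma deduction_sequence_sound:
  assumes ded: "deduction_sequence S t \<phi>"
    and model: "\<forall>C\<in>S. clause_true v C"
    and "1 \<le> i" "i \<le> t"
  shows "clause_true v (\<phi> i)"
  using assms(3,4)
proof (induction i rule: less_induct)
  case (less i)
  have "i \<in> {1..t}"
    using less.prems by simp
  then consider "\<phi> i \<in> S"
    | k r where "\<forall>j\<in>{1..k}. 1 \<le> r j \<and> r j < i" "is_cs_clause k (\<lambda>j. \<phi> (r j)) (\<phi> i)"
    using ded unfolding deduction_sequence_def by blast
  then show ?case
  proof cases
    case 1
    then show ?thesis
      using model by blast
  next
    case 2
    have "clause_true v (\<phi> (r j))" if "j \<in> {1..k}" for j
    proof -
      have "1 \<le> r j" "r j < i"
        using 2(1) that by auto
      then show ?thesis
        using less.IH less.prems by simp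
    qed
    then show ?thesis
      using is_cs_clause_sound[OF 2(2)] by blast
  qed
qed

theorem theorem4p2:
  fixes S :: "'a clause set" and t :: nat and \<phi> :: "nat \<Rightarrow> 'a clause"
  assumes "finite S"
    and "deduction_sequence S t \<phi>"
    and "\<phi> t = {||}"
  shows "\<not> satisfiable S"
proof
  assume "satisfiable S"
  then obtain v where "\<forall>C\<in>S. clause_true v C"
    by (auto simp: satisfiable_def)
  \<comment> \<open>This ensures that \<open>\<phi> t\<close> is an actual entry of the sequence, as
    \<open>\<phi> 0\<close> is arbitrary.\<close>
  moreover have "1 \<le> t"
    using assms(2) by (simp add: deduction_sequence_def)
  ultimately have "clause_true v (\<phi> t)"
    using deduction_sequence_sound[OF assms(2)] by blast
  then show False
    using assms(3) by (simp add: clause_true_def)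
qed

end
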